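(* Let $p:\mathbb{R}\to\mathbb{R}$ be non-decreasing and Lipschitz continuous with Lipschitz constant $\mu>0$. Let $h>0$, $\varphi>0$, $\Delta t>0$ and $\lambda=\Delta t/h$. Let $(u_j^n)_{j\in\mathbb{Z}}$ be grid data with compact (finite) support and let $(u_j^{n+1})_{j\in\mathbb{Z}}$ be obtained from one step of the first order relaxed scheme $$u_j^{n+1}=u_j^n+\frac{\lambda}{2}\Big(\partial_xp(u^n)|_{j+1}-\partial_xp(u^n)|_{j-1}\Big)+\frac{\lambda}{2}\varphi\Big(p(u_{j+1}^n)-2p(u_j^n)+p(u_{j-1}^n)\Big),$$ where the derivative is approximated by the centered difference $\partial_xp(u^n)|_{j}=\frac{p(u^n_{j+1})-p(u^n_{j-1})}{2h}$. If $$\Delta t\le\frac{2h^2}{\mu}\,\frac{1}{1+2h\varphi},$$ then the scheme is total variation non-increasing: $\mathrm{TV}(u^{n+1})\le\mathrm{TV}(u^n)$.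
   Context: For grid data $(u_j)_{j\in\mathbb{Z}}$, $\mathrm{TV}(u)=\sum_j|u_j-u_{j-1}|$. The scheme is the piecewise-constant reconstruction / forward Euler relaxed scheme for $u_t=(p(u))_{xx}$ on a uniform grid with spacing $h$ and time step $\Delta t$; $\varphi$ is a positive parameter (a velocity). *)

theory Defs
  imports "HOL-Analysis.Analysis"
begin

text \<open>
  The total variation takes values in \<open>[0, \<infinity>]\<close>, so that it is the mathematical value of the series
  for arbitrary grid data, with no default value in the divergent case.
\<close>

definition grid_TV :: "(int \<Rightarrow> real) \<Rightarrow> ennreal" where
  "grid_TV u = (\<Sum>\<^sub>\<infinity>j\<in>UNIV. ennreal \<bar>u j - u (j - 1)\<bar>)"

definition centered_diff :: "real \<Rightarrow> (int \<Rightarrow> real) \<Rightarrow> int \<Rightarrow> real" where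
  "centered_diff h w j = (w (j + 1) - w (j - 1)) / (2 * h)"

definition relaxed_step ::
  "(real \<Rightarrow> real) \<Rightarrow> real \<Rightarrow> real \<Rightarrow> real \<Rightarrow> (int \<Rightarrow> real) \<Rightarrow> int \<Rightarrow> real" where
  "relaxed_step p h lam \<phi> u j =
     u j
     + lam / 2 * (centered_diff h (p \<circ> u) (j + 1) - centered_diff h (p \<circ> u) (j - 1))
     + lam / 2 * \<phi> * (p (u (j + 1)) - 2 * p (u j) + p (u (j - 1)))"

end

(*
  Write w = p(u), d j = u j - u (j - 1), e j = w j - w (j - 1), A = lam / (4 h) and
  B = lam \<phi> / 2.  The differences of the new data are
    (d j - (2 A + 2 B) e j) + A (e (j + 2) + e (j - 2)) + B (e (j + 1) + e (j - 1)).
  The time step restriction says (2 A + 2 B) \<mu> \<le> 1.  As e j has the sign of d j and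
  |e j| \<le> \<mu> |d j|, the bracket has modulus |d j| - (2 A + 2 B) |e j|; summing over j, the
  shifted terms exactly restore what is lost there.
*)
theory Submission
  imports Defs
begin

text \<open>Every family in \<open>ennreal\<close> is summable, so sums there can be split and
  compared with no side conditions.\<close>

lemma infsum_add_ennreal:
  fixes f g :: "'a \<Rightarrow> ennreal"
  shows "(\<Sum>\<^sub>\<infinity>x\<in>A. f x + g x) = infsum f A + infsum g A"
  by (intro infsum_add nonneg_summable_on_complete) auto

lemma infsum_mono_ennreal:
  fixes f g :: "'a \<Rightarrow> ennreal"
  assumes "\<And>x. x \<in> A \<Longrightarrow> f x \<le> g x"
  shows "infsum f A \<le> infsum g A"
  by (intro infsum_mono nonneg_summable_on_complete assms) auto

lemma infsum_int_shift:
  fixes f :: "int \<Rightarrow> 'a::{comm_monoid_add,t2_space}"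
  shows "(\<Sum>\<^sub>\<infinity>j\<in>UNIV. f (j + k)) = infsum f UNIV"
  by (rule infsum_reindex_bij_betw) (rule bij_plus_right)

text \<open>Subtracting \<open>c * (p x - p y)\<close> moves \<open>x - y\<close> towards zero by
  monotonicity, and \<open>c * \<mu> \<le> 1\<close> prevents overshooting, so the modulus drops by
  exactly the amount subtracted.\<close>

lemma abs_diff_mono_lipschitz:
  fixes p :: "real \<Rightarrow> real"
  assumes mono: "mono p" and lip: "\<mu>-lipschitz_on UNIV p"
    and c: "0 \<le> c" "c * \<mu> \<le> 1"
  shows "\<bar>(x - y) - c * (p x - p y)\<bar> + c * \<bar>p x - p y\<bar> = \<bar>x - y\<bar>"
proof -
  have "\<bar>p x - p y\<bar> \<le> \<mu> * \<bar>x - y\<bar>"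
    using lipschitz_onD[OF lip, of x y] by (simp add: dist_real_def)
  then have "c * \<bar>p x - p y\<bar> \<le> (c * \<mu>) * \<bar>x - y\<bar>"
    using c(1) by (simp add: mult.assoc mult_left_mono)
  also have "\<dots> \<le> \<bar>x - y\<bar>"
    using mult_right_mono[OF c(2), of "\<bar>x - y\<bar>"] by simp
  finally have le: "c * \<bar>p x - p y\<bar> \<le> \<bar>x - y\<bar>" .
  show ?thesis
  proof (cases "y \<le> x")
    case True
    then have "p y \<le> p x" using mono by (rule monoD[rotated])
    with True le show ?thesis by (simp add: abs_if)
  next
    case False
    then have "p x \<le> p y" using mono by (auto intro: monoD)
    with False have "\<bar>p x - p y\<bar> = p y - p x" "\<bar>x - y\<bar> = y - x" by auto
    with le show ?thesis by (simp add: algebra_simps)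
  qed
qed

theorem mainTheorem4:
  fixes p :: "real \<Rightarrow> real"
    and \<mu> h \<phi> dt lam :: real
    and u u_new :: "int \<Rightarrow> real"
  assumes "mono p"
    and "\<mu> > 0"
    and "\<mu>-lipschitz_on UNIV p"
    and "h > 0"
    and "\<phi> > 0"
    and "dt > 0"
    and "lam = dt / h"
    and "finite {j. u j \<noteq> 0}"
    and "\<And>j. u_new j = relaxed_step p h lam \<phi> u j"
    and "dt \<le> 2 * h\<^sup>2 / \<mu> * (1 / (1 + 2 * h * \<phi>))"
  shows "grid_TV u_new \<le> grid_TV u"
proof -
  define A where "A = lam / (4 * h)"
  define B where "B = lam * \<phi> / 2"
  define d where "d j = u j - u (j - 1)" for j
  define e where "e j = p (u j) - p (u (j - 1))" for j
  define a where "a j = ennreal (A * \<bar>e j\<bar>)" for j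
  define b where "b j = ennreal (B * \<bar>e j\<bar>)" for j
  have pos: "0 \<le> A" "0 \<le> B"
    using assms(4-7) by (auto simp: A_def B_def)
  have "0 < 1 + 2 * h * \<phi>"
    using assms(4,5) by (simp add: add_pos_pos)
  then have "0 < (1 + 2 * h * \<phi>) * \<mu>"
    using assms(2) by simp
  moreover have "dt \<le> 2 * h\<^sup>2 / ((1 + 2 * h * \<phi>) * \<mu>)"
    using assms(10) by (simp add: mult.commute)
  ultimately have "dt * (1 + 2 * h * \<phi>) * \<mu> \<le> 2 * h\<^sup>2"
    by (simp only: pos_le_divide_eq mult.assoc)
  moreover have "(2 * A + 2 * B) * \<mu> = dt * (1 + 2 * h * \<phi>) * \<mu> / (2 * h\<^sup>2)"
    using assms(4) by (simp add: A_def B_def assms(7) field_simps power2_eq_square)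
  ultimately have cfl: "(2 * A + 2 * B) * \<mu> \<le> 1"
    using assms(4) by (simp add: divide_le_eq_1)
  have key: "\<bar>d j - (2 * A + 2 * B) * e j\<bar> + (2 * A + 2 * B) * \<bar>e j\<bar> = \<bar>d j\<bar>" for j
    unfolding d_def e_def
    by (rule abs_diff_mono_lipschitz[OF assms(1,3) _ cfl]) (use pos in simp)
  \<comment> \<open>A centered difference of centered differences is a second difference of width 2,
    hence the points \<open>j + 2\<close> and \<open>j - 2\<close> and the factor
    \<open>lam / 2 * (1 / (2 * h)) = A\<close>.\<close>
  have step: "u_new j = u j + A * (p (u (j + 2)) - 2 * p (u j) + p (u (j - 2)))
      + B * (p (u (j + 1)) - 2 * p (u j) + p (u (j - 1)))" for j
    using assms(4)
    by (simp add: assms(9) relaxed_step_def centered_diff_def A_def B_def field_simps)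
  have new: "u_new j - u_new (j - 1) = (d j - (2 * A + 2 * B) * e j)
      + A * e (j + 2) + A * e (j - 2) + B * e (j + 1) + B * e (j - 1)" for j
    by (simp add: step d_def e_def algebra_simps)
  \<comment> \<open>The loss stands on the left as an added term because subtraction in
    \<open>ennreal\<close> truncates at zero. Writing \<open>j + -2\<close> for \<open>j - 2\<close>
    matches the form of \<open>infsum_int_shift\<close>.\<close>
  have pointwise: "ennreal \<bar>u_new j - u_new (j - 1)\<bar> + (a j + a j + b j + b j)
      \<le> ennreal \<bar>d j\<bar> + (a (j + 2) + a (j + -2) + b (j + 1) + b (j + -1))" for j
  proof -
    have "\<bar>u_new j - u_new (j - 1)\<bar> \<le> \<bar>d j - (2 * A + 2 * B) * e j\<bar>
        + \<bar>A * e (j + 2)\<bar> + \<bar>A * e (j - 2)\<bar> + \<bar>B * e (j + 1)\<bar> + \<bar>B * e (j - 1)\<bar>"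
      unfolding new by linarith
    then have "\<bar>u_new j - u_new (j - 1)\<bar>
        + (A * \<bar>e j\<bar> + A * \<bar>e j\<bar> + B * \<bar>e j\<bar> + B * \<bar>e j\<bar>)
      \<le> \<bar>d j\<bar> + (A * \<bar>e (j + 2)\<bar> + A * \<bar>e (j + -2)\<bar> + B * \<bar>e (j + 1)\<bar> + B * \<bar>e (j + -1)\<bar>)"
      using key[of j] pos by (simp add: abs_mult algebra_simps)
    then show ?thesis
      unfolding a_def b_def using pos by (simp flip: ennreal_plus)
  qed
  define S where "S = infsum a UNIV + infsum a UNIV + infsum b UNIV + infsum b UNIV"
  have "(\<Sum>\<^sub>\<infinity>j. ennreal \<bar>u_new j - u_new (j - 1)\<bar> + (a j + a j + b j + b j))
      \<le> (\<Sum>\<^sub>\<infinity>j. ennreal \<bar>d j\<bar> + (a (j + 2) + a (j + -2) + b (j + 1) + b (j + -1)))"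
    by (rule infsum_mono_ennreal) (rule pointwise)
  \<comment> \<open>Summation over all integers makes the shifts disappear, so the loss and the gain
    are the same number \<open>S\<close>.\<close>
  then have sum_le: "grid_TV u_new + S \<le> grid_TV u + S"
    unfolding infsum_add_ennreal infsum_int_shift by (simp add: grid_TV_def d_def S_def)
  \<comment> \<open>Cancelling \<open>S\<close> requires it to be finite. Dropping the first modulus
    in \<open>key\<close> bounds it termwise by the variation of \<open>u\<close>; if that variation
    is infinite, the claim is trivial.\<close>
  have "a j + a j + b j + b j \<le> ennreal \<bar>d j\<bar>" for j
  proof -
    have "A * \<bar>e j\<bar> + A * \<bar>e j\<bar> + B * \<bar>e j\<bar> + B * \<bar>e j\<bar> \<le> \<bar>d j\<bar>"
      using key[of j] by (simp add: algebra_simps)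
    then show ?thesis
      unfolding a_def b_def using pos by (simp flip: ennreal_plus)
  qed
  then have "(\<Sum>\<^sub>\<infinity>j. a j + a j + b j + b j) \<le> (\<Sum>\<^sub>\<infinity>j. ennreal \<bar>d j\<bar>)"
    by (rule infsum_mono_ennreal)
  then have S_le: "S \<le> grid_TV u"
    unfolding infsum_add_ennreal by (simp add: grid_TV_def d_def S_def)
  show ?thesis
  proof (cases "grid_TV u = top")
    case False
    with S_le have "S \<noteq> top" by (auto simp: top_unique)
    with sum_le show ?thesis by (simp add: add.commute[of _ S] ennreal_add_left_cancel_le)
  qed simp
qed

end
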